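(* For $n\ge 1$ let $b_n=|s^{-1}(\mathrm{Av}_n(132,312))|$ be the number of permutations $p$ of length $n$ such that $s(p)$ avoids both patterns $132$ and $312$, where $s$ is the stack sorting operation; set $b_0=0$. Let $a_n$ be the number of 0-1-trees on $n$ vertices for $n \ge 1$, and set $a_0=0$. Then the sequence $(b_n)$ satisfies the recurrence relation $$b_n=2b_{n-1}+2\sum_{i=2}^{n-1} b_{i-1}b_{n-i}\qquad (n\ge 2),$$ which is the same recurrence relation that is satisfied by $(a_n)$, namely $a_n=2a_{n-1}+2\sum_{i=2}^{n-1}a_{i-1}a_{n-i}$ for $n\ge 2$. As $a_1=b_1=1$, this implies that $a_n=b_n$ for all $n$.
   Context: Stack sorting operation $s$: it is defined recursively on all finite permutations and their substrings (i.e. on finite strings of distinct positive integers) by $s(\varepsilon)=\varepsilon$ for the empty string $\varepsilon$, and, for a nonempty string $p=LmR$ where $m$ is the maximum entry of $p$, $L$ is the (possibly empty) string of entries to the left of $m$ and $R$ is the (possibly empty) string of entries to the right of $m$, by $s(p)=s(L)\,s(R)\,m$ (concatenation). Pattern avoidance: a permutation $p=p_1p_2\cdots p_n$ contains the pattern $q=q_1q_2\cdots q_k$ if there are indices $i_1<i_2<\cdots<i_k$ such that for all $r,t$, $p_{i_r}<p_{i_t}$ if and only if $q_r<q_t$; otherwise $p$ avoids $q$. $\mathrm{Av}_n(q,q')$ denotes the set of permutations of length $n$ (of $\{1,\dots,n\}$) that avoid both $q$ and $q'$, and $s^{-1}(\mathrm{Av}_n(q,q'))$ is the set of permutations $p$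 of length $n$ with $s(p)\in \mathrm{Av}_n(q,q')$. 0-1-trees: a plane binary tree is a rooted plane tree on unlabeled vertices in which every non-leaf vertex has one or two children, and every child is a left child or a right child, even if it is the only child of its parent (so a vertex with only a left child is distinguished from a vertex with only a right child, and a vertex with two children has one left child and one right child). A 0-1-tree is a plane binary tree in which every vertex that has two children is labeled $0$ or $1$ (other vertices carry no label). *)

theory Defs
  imports "HOL-Combinatorics.Multiset_Permutations"
begin

section \<open>Stack sorting\<close>

text \<open>
  A permutation of length \<open>n\<close> is the list of its entries \<open>p\<^sub>1, \<dots>, p\<^sub>n\<close>, that is, an element of
  \<^term>\<open>permutations_of_set {1..n}\<close>. The function below is total on lists, but it is intended only
  for lists of distinct entries, where the decomposition \<open>p = L @ m # R\<close> around the maximum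
  entry \<open>m\<close> is unique.
\<close>

function stack_sort :: "nat list \<Rightarrow> nat list" where
  "stack_sort [] = []"
| "stack_sort (x # xs) =
     (let p = x # xs;
          m = Max (set p);
          L = takeWhile (\<lambda>y. y \<noteq> m) p;
          R = tl (dropWhile (\<lambda>y. y \<noteq> m) p)
      in stack_sort L @ stack_sort R @ [m])"
  by pat_completeness auto
termination
proof (relation "measure length", goal_cases)
  case 1
  show ?case by simp
next
  case (2 x xs p m L)
  have "m \<in> set p"
    using 2(1,2) Max_in[of "set p"] by simp
  then have "dropWhile (\<lambda>y. y \<noteq> m) p \<noteq> []"
    by auto
  then have "0 < length (dropWhile (\<lambda>y. y \<noteq> m) p)"
    unfolding length_greater_0_conv .
  moreover have "length L + length (dropWhile (\<lambda>y. y \<noteq> m) p) = length p"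
    unfolding 2(3) length_append[symmetric] takeWhile_dropWhile_id ..
  ultimately have "length L < length p"
    by linarith
  then show ?case
    using 2(1) by simp
next
  case (3 x xs p m L R)
  have "length R < length p"
    using 3(1,4) length_dropWhile_le[of "\<lambda>y. y \<noteq> m" p] by simp
  then show ?case
    using 3(1) by simp
qed


section \<open>Pattern avoidance\<close>

text \<open>Positions are counted from \<open>0\<close>, and \<open>i\<close> is the increasing choice of positions in \<open>p\<close>.\<close>

definition contains_pattern :: "nat list \<Rightarrow> nat list \<Rightarrow> bool" where
  "contains_pattern p q \<longleftrightarrow>
     (\<exists>i :: nat \<Rightarrow> nat.
        strict_mono_on {..<length q} i \<and>
        i ` {..<length q} \<subseteq> {..<length p} \<and>
        (\<forall>r < length q. \<forall>t < length q. p ! i r < p ! i t \<longleftrightarrow> q ! r < q ! t))"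

definition Av :: "nat \<Rightarrow> nat list \<Rightarrow> nat list \<Rightarrow> nat list set" where
  "Av n q q' =
     {p \<in> permutations_of_set {1..n}. \<not> contains_pattern p q \<and> \<not> contains_pattern p q'}"

definition stack_sort_preimage_Av :: "nat \<Rightarrow> nat list \<Rightarrow> nat list \<Rightarrow> nat list set" where
  "stack_sort_preimage_Av n q q' = {p \<in> permutations_of_set {1..n}. stack_sort p \<in> Av n q q'}"

definition b_seq :: "nat \<Rightarrow> nat" where
  "b_seq n = (if n = 0 then 0 else card (stack_sort_preimage_Av n [1, 3, 2] [3, 1, 2]))"


section \<open>0-1-trees\<close>

datatype label = Zero | One

text \<open>
  Each constructor builds a tree from its root vertex, according to which children the root has.
  There is no empty tree, and only a root with two children carries a label.
\<close>

datatype zero_one_tree =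
  Leaf
| Left_Only zero_one_tree
| Right_Only zero_one_tree
| Both label zero_one_tree zero_one_tree

fun num_vertices :: "zero_one_tree \<Rightarrow> nat" where
  "num_vertices Leaf = 1"
| "num_vertices (Left_Only t) = 1 + num_vertices t"
| "num_vertices (Right_Only t) = 1 + num_vertices t"
| "num_vertices (Both c l r) = 1 + num_vertices l + num_vertices r"

definition a_seq :: "nat \<Rightarrow> nat" where
  "a_seq n = (if n = 0 then 0 else card {t. num_vertices t = n})"

end

theory Submission
  imports Defs
begin

text \<open>
  A list avoids both 132 and 312 iff no entry lies strictly between two earlier entries: in either
  pattern, the last entry has the middle value. Let \<open>p = L n R\<close> be a permutation of length \<open>n\<close>
  with maximum \<open>n\<close>, so that \<open>s(p) = s(L) s(R) n\<close>. The final \<open>n\<close> is never between earlier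
  entries, hence only \<open>s(L) s(R)\<close> matters.

  If \<open>L\<close> or \<open>R\<close> is empty, the condition is the same condition on the other part; for
  \<open>n \<ge> 2\<close> this yields the term \<open>2 b\<^sub>n\<^sub>-\<^sub>1\<close>. Otherwise, no entry of \<open>R\<close> may lie between two
  entries of \<open>L\<close>, so the values of \<open>L\<close> form a block of consecutive integers. Let \<open>x\<close> be the first
  entry of \<open>s(R)\<close>. An entry \<open>y\<close> of \<open>R\<close> with a value between \<open>x\<close> and the block would come later in
  \<open>s(R)\<close> and would be between \<open>x\<close> and an entry of \<open>L\<close>, so the block is directly above or
  directly below \<open>x\<close>. Conversely, in both positions the block behaves towards every later entry just
  as \<open>x\<close> itself does, so the only remaining condition is that \<open>s(L)\<close> and \<open>s(R)\<close> both avoid the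
  patterns. Thus \<open>p\<close> is determined by the relative orders of \<open>L\<close> and of \<open>R\<close>, each chosen freely,
  and one binary choice; this yields the terms \<open>2 b\<^sub>i\<^sub>-\<^sub>1 b\<^sub>n\<^sub>-\<^sub>i\<close>, where \<open>i\<close> is the position of
  \<open>n\<close>. The lemma \<open>never_between_block_iff\<close> carries the two choices, and \<open>inj_on_glue\<close>
  together with \<open>sorts_well_decomposition\<close> carries the bijection.

  A 0-1-tree with at least two vertices has a root with a single left child, a single right child,
  or two children and one of two labels, which gives the same recurrence.
\<close>

section \<open>Stack sorting\<close>

declare stack_sort.simps(2) [simp del]

lemma stack_sort_split:
  assumes "\<And>y. y \<in> set L \<union> set R \<Longrightarrow> y < m"
  shows "stack_sort (L @ m # R) = stack_sort L @ stack_sort R @ [m]"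
proof -
  obtain x xs where p: "L @ m # R = x # xs"
    by (cases "L @ m # R") auto
  have "Max (set (L @ m # R)) = m"
    using assms by (intro Max_eqI) (auto intro: less_imp_le)
  moreover have "takeWhile (\<lambda>y. y \<noteq> m) (L @ m # R) = L"
    using assms by (subst takeWhile_append2) auto
  moreover have "dropWhile (\<lambda>y. y \<noteq> m) (L @ m # R) = m # R"
    using assms by (subst dropWhile_append2) auto
  ultimately show ?thesis
    using stack_sort.simps(2)[of x xs] unfolding p[symmetric] by (simp add: Let_def)
qed

lemma stack_sort_singleton: "stack_sort [m] = [m]"
  using stack_sort_split[of "[]" "[]" m] by simp

lemma split_at_Max:
  fixes p :: "nat list"
  assumes "distinct p" "p \<noteq> []"
  obtains L m R where "p = L @ m # R" "\<And>y. y \<in> set L \<union> set R \<Longrightarrow> y < m"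
proof -
  have "Max (set p) \<in> set p"
    using assms by simp
  then obtain L R where p: "p = L @ Max (set p) # R"
    by (meson split_list)
  have "y < Max (set p)" if "y \<in> set L \<union> set R" for y
  proof -
    have "y \<in> set p"
      using that by (subst p) auto
    moreover have "Max (set p) \<notin> set L \<union> set R"
      using assms(1) p by (metis Un_iff distinct.simps(2) distinct_append not_distinct_conv_prefix)
    ultimately show ?thesis
      using that by (metis List.finite_set Max_ge nat_less_le)
  qed
  with p show thesis
    by (rule that)
qed

text \<open>
  Induction along the decomposition around the maximum entry, which lets later proofs use
  \<open>stack_sort_split\<close> in place of the recursive equation with its \<^const>\<open>takeWhile\<close> and
  \<^const>\<open>dropWhile\<close>.
\<close>

lemma distinct_stack_sort_induct [consumes 1, case_names Nil split]:
  fixes p :: "nat list"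
  assumes "distinct p"
    and "P []"
    and "\<And>L m R. \<lbrakk>distinct (L @ m # R); \<And>y. y \<in> set L \<union> set R \<Longrightarrow> y < m; P L; P R\<rbrakk>
           \<Longrightarrow> P (L @ m # R)"
  shows "P p"
  using assms(1)
proof (induction "length p" arbitrary: p rule: less_induct)
  case less
  show ?case
  proof (cases "p = []")
    case True
    then show ?thesis using assms(2) by simp
  next
    case False
    then obtain L m R where p: "p = L @ m # R" "\<And>y. y \<in> set L \<union> set R \<Longrightarrow> y < m"
      using split_at_Max[OF less.prems False] by metis
    then show ?thesis
      using less.hyps[of L] less.hyps[of R] less.prems assms(3)[of L m R] by auto
  qed
qed

lemma mset_stack_sort: "distinct p \<Longrightarrow> mset (stack_sort p) = mset p"
proof (induction p rule: distinct_stack_sort_induct)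
  case (split L m R)
  then show ?case
    by (subst stack_sort_split) auto
qed simp

lemma set_stack_sort: "distinct p \<Longrightarrow> set (stack_sort p) = set p"
  by (metis mset_stack_sort mset_eq_setD)

lemma distinct_stack_sort: "distinct p \<Longrightarrow> distinct (stack_sort p)"
  by (metis mset_stack_sort mset_eq_imp_distinct_iff)

lemma stack_sort_eq_Nil_iff: "distinct p \<Longrightarrow> stack_sort p = [] \<longleftrightarrow> p = []"
  by (metis set_stack_sort set_empty)

text \<open>
  Stack sorting sees only the relative order of the entries. This is what allows \<open>L\<close> and \<open>R\<close>
  to be replaced by permutations of initial segments.
\<close>

lemma stack_sort_map:
  assumes "distinct p" "strict_mono_on (set p) f"
  shows "stack_sort (map f p) = map f (stack_sort p)"
  using assms
proof (induction p rule: distinct_stack_sort_induct)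
  case Nil
  then show ?case by simp
next
  case (split L m R)
  have sub: "strict_mono_on (set L) f" "strict_mono_on (set R) f"
    using split.prems by (auto simp: strict_mono_on_def)
  have "f y < f m" if "y \<in> set L \<union> set R" for y
    using that split.hyps(2) by (intro strict_mono_onD[OF split.prems]) auto
  then have "stack_sort (map f L @ f m # map f R) =
      stack_sort (map f L) @ stack_sort (map f R) @ [f m]"
    by (intro stack_sort_split) auto
  also have "\<dots> = map f (stack_sort (L @ m # R))"
  proof -
    have "stack_sort (L @ m # R) = stack_sort L @ stack_sort R @ [m]"
      by (rule stack_sort_split) (use split.hyps(2) in blast)
    then show ?thesis
      using split.IH sub by simp
  qed
  finally show ?case
    by simp
qed


section \<open>Avoiding 132 and 312\<close>

text \<open>
  The set \<open>S\<close> holds the values that have come before the list, so that the condition can be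
  split at an append.
\<close>

fun never_between :: "nat set \<Rightarrow> nat list \<Rightarrow> bool" where
  "never_between S [] \<longleftrightarrow> True"
| "never_between S (x # xs) \<longleftrightarrow>
     \<not> (\<exists>a\<in>S. \<exists>b\<in>S. a < x \<and> x < b) \<and> never_between (insert x S) xs"

lemma never_between_append:
  "never_between S (xs @ ys) \<longleftrightarrow> never_between S xs \<and> never_between (S \<union> set xs) ys"
  by (induction xs arbitrary: S) auto

lemma never_betweenD:
  assumes "never_between S xs" "y \<in> set xs" "a \<in> S" "b \<in> S" "a < y"
  shows "\<not> y < b"
  using assms by (induction xs arbitrary: S) auto

lemma never_between_map:
  assumes "strict_mono_on (S \<union> set xs) f"
  shows "never_between (f ` S) (map f xs) \<longleftrightarrow> never_between S xs"
  using assms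
proof (induction xs arbitrary: S)
  case (Cons x xs)
  have "never_between (f ` insert x S) (map f xs) \<longleftrightarrow> never_between (insert x S) xs"
    by (rule Cons.IH) (use Cons.prems in simp)
  moreover have "f a < f x \<longleftrightarrow> a < x" "f x < f a \<longleftrightarrow> x < a" if "a \<in> S" for a
    using that Cons.prems by (auto simp: strict_mono_on_less)
  ultimately show ?case
    by auto
qed simp

lemma never_between_nth:
  "never_between {} p \<longleftrightarrow>
     (\<forall>k<length p. \<forall>i<k. \<forall>j<k. \<not> (p ! i < p ! k \<and> p ! k < p ! j))"
proof (induction p rule: rev_induct)
  case (snoc x p)
  have "never_between {} (p @ [x]) \<longleftrightarrow> never_between {} p \<and>
      \<not> (\<exists>a\<in>set p. \<exists>b\<in>set p. a < x \<and> x < b)"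
    by (simp add: never_between_append)
  moreover have "(\<exists>a\<in>set p. \<exists>b\<in>set p. a < x \<and> x < b) \<longleftrightarrow>
      (\<exists>i<length p. \<exists>j<length p. p ! i < x \<and> x < p ! j)"
    by (metis in_set_conv_nth)
  moreover have "(\<forall>k<length (p @ [x]). Q k) \<longleftrightarrow> (\<forall>k<length p. Q k) \<and> Q (length p)" for Q
    by (auto simp: less_Suc_eq)
  ultimately show ?case
    unfolding snoc by (auto simp: nth_append)
qed simp

text \<open>
  Pairing each chosen entry with the pattern value it stands for turns the order condition into a
  finite conjunction.
\<close>

lemma contains_pattern_length_3:
  "contains_pattern p [q0, q1, q2] \<longleftrightarrow>
     (\<exists>i j k. i < j \<and> j < k \<and> k < length p \<and>
        (\<forall>(x, q) \<in> {(p ! i, q0), (p ! j, q1), (p ! k, q2)}.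
         \<forall>(y, q') \<in> {(p ! i, q0), (p ! j, q1), (p ! k, q2)}. x < y \<longleftrightarrow> q < q'))"
  (is "_ \<longleftrightarrow> (\<exists>i j k. ?P i j k)")
proof
  have three: "{..<length [q0, q1, q2]} = {0, 1, 2}"
    by auto
  have all3: "(\<forall>r<length [q0, q1, q2]. Q r) \<longleftrightarrow> Q 0 \<and> Q 1 \<and> Q 2" for Q
    by (auto simp: less_Suc_eq numeral_2_eq_2)
  {
    assume "contains_pattern p [q0, q1, q2]"
    then obtain f where f: "strict_mono_on {0, 1, 2::nat} f" "f ` {0, 1, 2} \<subseteq> {..<length p}"
      "\<forall>r<length [q0, q1, q2]. \<forall>t<length [q0, q1, q2].
         p ! f r < p ! f t \<longleftrightarrow> [q0, q1, q2] ! r < [q0, q1, q2] ! t"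
      unfolding contains_pattern_def three by blast
    have "f 0 < f 1" "f 1 < f 2"
      using f(1) by (auto simp: strict_mono_on_def)
    then have "?P (f 0) (f 1) (f 2)"
      using f(2) f(3)[unfolded all3] by auto
    then show "\<exists>i j k. ?P i j k"
      by blast
  next
    assume "\<exists>i j k. ?P i j k"
    then obtain i j k where ijk: "?P i j k"
      by blast
    define f where "f = (\<lambda>r::nat. if r = 0 then i else if r = 1 then j else k)"
    have "strict_mono_on {0, 1, 2} f" "f ` {0, 1, 2} \<subseteq> {..<length p}"
      using ijk by (auto simp: f_def strict_mono_on_def)
    moreover have "\<forall>r<length [q0, q1, q2]. \<forall>t<length [q0, q1, q2].
         p ! f r < p ! f t \<longleftrightarrow> [q0, q1, q2] ! r < [q0, q1, q2] ! t"
      unfolding all3 using ijk by (simp add: f_def)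
    ultimately show "contains_pattern p [q0, q1, q2]"
      unfolding contains_pattern_def three by blast
  }
qed

text \<open>
  The two patterns differ only in which of the first two chosen entries is the larger one, and in
  both the third chosen entry has the middle value.
\<close>

lemma avoids_132_312_iff_never_between:
  "\<not> contains_pattern p [1, 3, 2] \<and> \<not> contains_pattern p [3, 1, 2] \<longleftrightarrow> never_between {} p"
proof -
  have "contains_pattern p [1, 3, 2] \<longleftrightarrow>
      (\<exists>i j k. i < j \<and> j < k \<and> k < length p \<and> p ! i < p ! k \<and> p ! k < p ! j)"
    unfolding contains_pattern_length_3 by (intro ex_cong1) auto
  moreover have "contains_pattern p [3, 1, 2] \<longleftrightarrow>
      (\<exists>i j k. i < j \<and> j < k \<and> k < length p \<and> p ! j < p ! k \<and> p ! k < p ! i)"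
    unfolding contains_pattern_length_3 by (intro ex_cong1) auto
  ultimately show ?thesis
    unfolding never_between_nth
    by (smt (verit) linorder_neqE_nat order.strict_trans order.asym)
qed

definition sorts_well :: "nat \<Rightarrow> nat list set" where
  "sorts_well n = {p \<in> permutations_of_set {1..n}. never_between {} (stack_sort p)}"

lemma sorts_well_iff:
  "p \<in> sorts_well n \<longleftrightarrow> set p = {1..n} \<and> distinct p \<and> never_between {} (stack_sort p)"
  by (auto simp: sorts_well_def permutations_of_set_def)

lemma length_sorts_well: "p \<in> sorts_well n \<Longrightarrow> length p = n"
  using distinct_card[of p] by (auto simp: sorts_well_iff)

lemma finite_sorts_well: "finite (sorts_well n)"
  by (simp add: sorts_well_def)

lemma b_seq_eq_card_sorts_well: "n > 0 \<Longrightarrow> b_seq n = card (sorts_well n)"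
proof -
  have "stack_sort_preimage_Av n [1, 3, 2] [3, 1, 2] = sorts_well n"
    unfolding stack_sort_preimage_Av_def Av_def sorts_well_def avoids_132_312_iff_never_between
    by (intro Collect_cong)
      (metis permutations_of_setD permutations_of_setI set_stack_sort distinct_stack_sort mem_Collect_eq)
  then show "n > 0 \<Longrightarrow> b_seq n = card (sorts_well n)"
    by (simp add: b_seq_def)
qed


section \<open>Inserting a block of consecutive values\<close>

text \<open>
  Makes room for the \<open>k\<close> values \<open>t + 1, \<dots>, t + k\<close> by shifting everything above \<open>t\<close>.
\<close>

definition open_gap :: "nat \<Rightarrow> nat \<Rightarrow> nat \<Rightarrow> nat" where
  "open_gap t k y = (if y \<le> t then y else y + k)"

lemma strict_mono_on_open_gap: "strict_mono_on A (open_gap t k)"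
  by (auto simp: strict_mono_on_def open_gap_def)

lemma inj_open_gap: "inj (open_gap t k)"
  by (rule strict_mono_on_imp_inj_on[OF strict_mono_on_open_gap])

lemma image_open_gap:
  assumes "t \<le> m"
  shows "open_gap t k ` {1..m} = {1..m + k} - {t + 1..t + k}"
proof
  show "open_gap t k ` {1..m} \<subseteq> {1..m + k} - {t + 1..t + k}"
    by (auto simp: open_gap_def)
  show "{1..m + k} - {t + 1..t + k} \<subseteq> open_gap t k ` {1..m}"
  proof
    fix y
    assume "y \<in> {1..m + k} - {t + 1..t + k}"
    then have "y = open_gap t k (if y \<le> t then y else y - k)"
        "(if y \<le> t then y else y - k) \<in> {1..m}"
      using assms by (auto simp: open_gap_def)
    then show "y \<in> open_gap t k ` {1..m}"
      by blast
  qed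
qed

lemma image_add_block: "(\<lambda>x. x + t) ` {1..k} = {t + 1..t + (k::nat)}"
  by (simp add: image_add_atLeastAtMost' add.commute)

text \<open>
  A block inserted next to the value \<open>x\<close> compares with every value other than \<open>x\<close> in the
  same way as \<open>x\<close> does. When \<open>x\<close> itself has already occurred, the block therefore creates
  no new pair of values to be between. The block is directly above \<open>x\<close> for \<open>t = x\<close> and
  directly below it for \<open>t = x - 1\<close>.
\<close>

lemma never_between_open_gap:
  assumes "x \<in> T" "t = x \<or> t = x - 1" "0 < x" "distinct ys" "set ys \<inter> T = {}"
  shows "never_between ({t + 1..t + k} \<union> open_gap t k ` T) (map (open_gap t k) ys) \<longleftrightarrow>
           never_between T ys"
  using assms
proof (induction ys arbitrary: T)
  case (Cons y ys)
  let ?g = "open_gap t k" and ?S = "{t + 1..t + k}"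
  have IH: "never_between (?S \<union> ?g ` insert y T) (map ?g ys) \<longleftrightarrow> never_between (insert y T) ys"
    by (rule Cons.IH) (use Cons.prems in auto)
  have less: "?g a < ?g b \<longleftrightarrow> a < b" for a b
    by (auto simp: open_gap_def)
  have "y \<noteq> x"
    using Cons.prems by auto
  have below: "(\<exists>a \<in> ?S \<union> ?g ` T. a < ?g y) \<longleftrightarrow> (\<exists>a\<in>T. a < y)"
  proof
    assume "\<exists>a \<in> ?S \<union> ?g ` T. a < ?g y"
    then consider a where "a \<in> ?S" "a < ?g y" | a where "a \<in> T" "?g a < ?g y"
      by auto
    then show "\<exists>a\<in>T. a < y"
    proof cases
      case 1
      then have "t < y"
        by (auto simp: open_gap_def split: if_splits)
      then have "x < y"
        using Cons.prems(2) \<open>y \<noteq> x\<close> by auto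
      then show ?thesis using Cons.prems(1) by blast
    qed (auto simp: less)
  qed (use less in blast)
  have above: "(\<exists>b \<in> ?S \<union> ?g ` T. ?g y < b) \<longleftrightarrow> (\<exists>b\<in>T. y < b)"
  proof
    assume "\<exists>b \<in> ?S \<union> ?g ` T. ?g y < b"
    then consider b where "b \<in> ?S" "?g y < b" | b where "b \<in> T" "?g y < ?g b"
      by auto
    then show "\<exists>b\<in>T. y < b"
    proof cases
      case 1
      then have "y \<le> t"
        by (auto simp: open_gap_def split: if_splits)
      then have "y < x"
        using Cons.prems(2) \<open>y \<noteq> x\<close> \<open>0 < x\<close> by auto
      then show ?thesis using Cons.prems(1) by blast
    qed (auto simp: less)
  qed (use less in blast)
  show ?case
    using IH below above by simp
qed simp

text \<open>
  This is the source of the factor 2. If a value \<open>y\<close> of \<open>w\<close> separated the first entry of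
  \<open>w\<close> from the block, then \<open>y\<close>, which has to come later in \<open>w\<close>, would be between that
  first entry and the block.
\<close>

lemma never_between_block_iff:
  assumes "w \<noteq> []" "distinct w" "set w = {1..m}" "t \<le> m" "0 < k"
  shows "never_between {t + 1..t + k} (map (open_gap t k) w) \<longleftrightarrow>
           never_between {} w \<and> t \<in> {hd w - 1, hd w}"
proof -
  obtain x ys where w: "w = x # ys"
    using assms(1) by (cases w) auto
  let ?g = "open_gap t k" and ?S = "{t + 1..t + k}"
  have x: "0 < x"
    using assms(3) unfolding w by (metis atLeastAtMost_iff less_le_trans list.set_intros(1) zero_less_one)
  have ins: "?S \<union> ?g ` {x} = insert (?g x) ?S"
    by auto
  show ?thesis
  proof
    assume nb: "never_between {} w \<and> t \<in> {hd w - 1, hd w}"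
    then have t: "t = x \<or> t = x - 1"
      by (auto simp: w)
    then have "never_between (?S \<union> ?g ` {x}) (map ?g ys)"
      using never_between_open_gap[of x "{x}" t ys k] x assms(2) nb by (auto simp: w)
    then show "never_between ?S (map ?g w)"
      using t x unfolding ins by (auto simp: w open_gap_def)
  next
    assume nb: "never_between ?S (map ?g w)"
    then have rest: "never_between (insert (?g x) ?S) (map ?g ys)"
      by (simp add: w)
    have mem: "t + 1 \<in> ?S" "t + k \<in> ?S"
      using assms(5) by auto
    \<comment> \<open>Otherwise \<open>t\<close> is a value of \<open>w\<close> above \<open>x\<close> and below the block.\<close>
    have "\<not> x < t"
    proof
      assume "x < t"
      then have "t \<in> set ys"
        using assms(3,4) x w by (metis atLeastAtMost_iff less_imp_le not_less_eq_eq
            set_ConsD One_nat_def Suc_leI order.strict_trans)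
      then have "?g t \<in> set (map ?g ys)"
        by simp
      then show False
        using never_betweenD[OF rest, of "?g t" "?g x" "t + 1"] mem \<open>x < t\<close>
        by (simp add: open_gap_def)
    qed
    \<comment> \<open>Otherwise \<open>t + 1\<close>, which the gap moves just above the block, is still below the image of \<open>x\<close>.\<close>
    moreover have "\<not> t + 1 < x"
    proof
      assume "t + 1 < x"
      moreover have "x \<le> m"
        using assms(3) w by auto
      ultimately have "t + 1 \<in> set w"
        using assms(3) by auto
      then have "t + 1 \<in> set ys"
        using \<open>t + 1 < x\<close> w by auto
      then have "?g (t + 1) \<in> set (map ?g ys)"
        by (simp only: set_map image_eqI)
      then show False
        using never_betweenD[OF rest, of "?g (t + 1)" "t + k" "?g x"] mem \<open>t + 1 < x\<close>
        by (simp add: open_gap_def)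
    qed
    ultimately have t: "t = x \<or> t = x - 1"
      by auto
    have "never_between {x} ys"
      using rest never_between_open_gap[of x "{x}" t ys k] t x assms(2) unfolding ins
      by (auto simp: w)
    then show "never_between {} w \<and> t \<in> {hd w - 1, hd w}"
      using t by (auto simp: w)
  qed
qed

text \<open>
  A value missing from \<open>S\<close> between its minimum and its maximum would have to occur in
  \<open>xs\<close>, where it is forbidden.
\<close>

lemma never_between_complement_is_block:
  assumes "never_between S xs" "S \<noteq> {}" "S \<inter> set xs = {}" "S \<union> set xs = {1..N}" "card S = k"
  obtains t where "S = {t + 1..t + k}" "t + k \<le> N"
proof -
  have fin: "finite S"
    using assms(4) by (metis finite_Un finite_atLeastAtMost)
  have ge1: "1 \<le> Min S"
    using Min_in[OF fin assms(2)] assms(4) by auto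
  have mem: "Min S \<in> S" "Max S \<in> S"
    using fin assms(2) by auto
  have "S = {Min S..Max S}"
  proof
    show "{Min S..Max S} \<subseteq> S"
    proof
      fix y
      assume y: "y \<in> {Min S..Max S}"
      show "y \<in> S"
      proof (rule ccontr)
        assume "y \<notin> S"
        then have "y \<noteq> Min S" "y \<noteq> Max S"
          using mem by auto
        then have "Min S < y" "y < Max S"
          using y by auto
        moreover have "Max S \<in> {1..N}"
          using assms(4) mem by blast
        ultimately have "y \<in> {1..N}"
          using ge1 by auto
        then have "y \<in> set xs"
          using assms(4) \<open>y \<notin> S\<close> by blast
        then show False
          using never_betweenD[OF assms(1)] mem \<open>Min S < y\<close> \<open>y < Max S\<close> by blast
      qed
    qed
  qed (auto simp: fin)
  moreover have "Min S \<le> Max S"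
    using fin assms(2) by simp
  ultimately have "k = Max S + 1 - Min S"
    using assms(5) card_atLeastAtMost[of "Min S" "Max S"] by simp
  then have "S = {(Min S - 1) + 1..(Min S - 1) + k}" "(Min S - 1) + k = Max S"
    using ge1 \<open>Min S \<le> Max S\<close> \<open>S = {Min S..Max S}\<close> by simp_all
  moreover have "Max S \<le> N"
    using assms(4) mem by auto
  ultimately show thesis
    using that[of "Min S - 1"] by simp
qed


section \<open>The recurrence for permutations\<close>

text \<open>
  The permutation whose part before the maximum is ordered like \<open>l\<close> and occupies the block of
  values directly above \<open>t\<close>, and whose part after the maximum is ordered like \<open>r\<close>.
\<close>

definition glue :: "nat list \<Rightarrow> nat list \<Rightarrow> nat \<Rightarrow> nat list" where
  "glue l r t = map (\<lambda>x. x + t) l @ (length l + length r + 1) # map (open_gap t (length l)) r"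

lemma stack_sort_glue:
  assumes "distinct l" "set l = {1..k}" "distinct r" "set r = {1..m}" "t \<le> m"
  shows "stack_sort (glue l r t) =
    map (\<lambda>x. x + t) (stack_sort l) @ map (open_gap t k) (stack_sort r) @ [k + m + 1]"
proof -
  have len: "length l = k" "length r = m"
    using assms distinct_card[of l] distinct_card[of r] by simp_all
  have "y < k + m + 1"
    if "y \<in> set (map (\<lambda>x. x + t) l) \<union> set (map (open_gap t k) r)" for y
    using that assms by (auto simp: open_gap_def)
  then have "stack_sort (glue l r t) =
      stack_sort (map (\<lambda>x. x + t) l) @ stack_sort (map (open_gap t k) r) @ [k + m + 1]"
    unfolding glue_def len by (rule stack_sort_split)
  moreover have "strict_mono_on (set l) (\<lambda>x. x + t)"
    by (simp add: strict_mono_on_def)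
  ultimately show ?thesis
    using assms by (simp add: stack_sort_map strict_mono_on_open_gap)
qed

lemma glue_in_sorts_well_iff:
  assumes "distinct l" "set l = {1..k}" "distinct r" "set r = {1..m}" "t \<le> m" "0 < k" "0 < m"
  shows "glue l r t \<in> sorts_well (k + m + 1) \<longleftrightarrow>
    l \<in> sorts_well k \<and> r \<in> sorts_well m \<and> t \<in> {hd (stack_sort r) - 1, hd (stack_sort r)}"
proof -
  have len: "length l = k" "length r = m"
    using assms distinct_card[of l] distinct_card[of r] by simp_all
  have sets: "(\<lambda>x. x + t) ` set l = {t + 1..t + k}"
      "open_gap t k ` set r = {1..m + k} - {t + 1..t + k}"
    using assms image_add_block image_open_gap by simp_all
  have "set (glue l r t) = {t + 1..t + k} \<union> {k + m + 1} \<union> ({1..m + k} - {t + 1..t + k})"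
    unfolding glue_def len by (auto simp: sets simp del: One_nat_def)
  also have "\<dots> = {1..k + m + 1}"
    using assms by auto
  finally have set: "set (glue l r t) = {1..k + m + 1}" .
  have dist: "distinct (glue l r t)"
    unfolding glue_def len using assms sets
    by (auto simp: distinct_map intro: inj_onI inj_on_subset[OF inj_open_gap])
  have sorted_r: "stack_sort r \<noteq> []" "distinct (stack_sort r)" "set (stack_sort r) = {1..m}"
    using assms by (auto simp: stack_sort_eq_Nil_iff distinct_stack_sort set_stack_sort)
  have "never_between {} (stack_sort (glue l r t)) \<longleftrightarrow>
      never_between {} (map (\<lambda>x. x + t) (stack_sort l)) \<and>
      never_between {t + 1..t + k} (map (open_gap t k) (stack_sort r)) \<and>
      never_between ({t + 1..t + k} \<union> open_gap t k ` set r) [k + m + 1]"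
  proof -
    have "set (map (\<lambda>x. x + t) (stack_sort l)) = {t + 1..t + k}"
      using assms(1) sets(1) by (simp only: set_map set_stack_sort)
    moreover have "set (map (open_gap t k) (stack_sort r)) = open_gap t k ` set r"
      using assms(3) by (simp only: set_map set_stack_sort)
    ultimately show ?thesis
      unfolding stack_sort_glue[OF assms(1-5)] never_between_append by simp
  qed
  moreover have "never_between ({t + 1..t + k} \<union> open_gap t k ` set r) [k + m + 1]"
    using assms(5) by (auto simp: sets)
  moreover have "never_between {} (map (\<lambda>x. x + t) (stack_sort l)) \<longleftrightarrow> never_between {} (stack_sort l)"
    using never_between_map[of "{}" "stack_sort l" "\<lambda>x. x + t"] by (simp add: strict_mono_on_def)
  moreover have "never_between {t + 1..t + k} (map (open_gap t k) (stack_sort r)) \<longleftrightarrow>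
      never_between {} (stack_sort r) \<and> t \<in> {hd (stack_sort r) - 1, hd (stack_sort r)}"
    using never_between_block_iff[OF sorted_r assms(5,6)] .
  ultimately show ?thesis
    using set dist assms by (simp only: sorts_well_iff) blast
qed

text \<open>
  The component \<open>i\<close> is the position of the maximum in the glued permutation, counted from 1;
  its bounds keep both parts nonempty.
\<close>

definition glue_data :: "nat \<Rightarrow> (nat \<times> nat list \<times> nat list \<times> nat) set" where
  "glue_data n = (SIGMA i:{2..n - 1}. SIGMA l:sorts_well (i - 1). SIGMA r:sorts_well (n - i).
     {hd (stack_sort r) - 1, hd (stack_sort r)})"

lemma hd_stack_sort_bounds:
  assumes "r \<in> sorts_well m" "0 < m"
  shows "1 \<le> hd (stack_sort r)" "hd (stack_sort r) \<le> m"
proof -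
  have "stack_sort r \<noteq> []" "set (stack_sort r) = {1..m}"
    using assms by (auto simp: sorts_well_iff stack_sort_eq_Nil_iff set_stack_sort)
  then have "hd (stack_sort r) \<in> {1..m}"
    using hd_in_set by blast
  then show "1 \<le> hd (stack_sort r)" "hd (stack_sort r) \<le> m"
    by auto
qed

lemma glue_dataE:
  assumes "(i, l, r, t) \<in> glue_data n"
  obtains "2 \<le> i" "i < n" "l \<in> sorts_well (i - 1)" "r \<in> sorts_well (n - i)" "t \<le> n - i"
    "t \<in> {hd (stack_sort r) - 1, hd (stack_sort r)}"
proof -
  have "2 \<le> i" "i < n" "l \<in> sorts_well (i - 1)" "r \<in> sorts_well (n - i)"
    "t \<in> {hd (stack_sort r) - 1, hd (stack_sort r)}"
    using assms by (auto simp: glue_data_def)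
  with hd_stack_sort_bounds[of r "n - i"] show thesis
    by (intro that) auto
qed

lemma card_glue_data:
  "card (glue_data n) = 2 * (\<Sum>i = 2..n - 1. card (sorts_well (i - 1)) * card (sorts_well (n - i)))"
proof -
  \<comment> \<open>The head is at least 1, so that the truncated subtraction gives a different number.\<close>
  have two: "card {hd (stack_sort r) - 1, hd (stack_sort r)} = 2"
    if "i \<in> {2..n - 1}" "r \<in> sorts_well (n - i)" for i r
  proof -
    have "0 < n - i"
      using that(1) by auto
    from hd_stack_sort_bounds(1)[OF that(2) this] show ?thesis
      by (auto simp: card_insert_if)
  qed
  have "card (SIGMA l:sorts_well (i - 1). SIGMA r:sorts_well (n - i).
         {hd (stack_sort r) - 1, hd (stack_sort r)})
       = 2 * (card (sorts_well (i - 1)) * card (sorts_well (n - i)))"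
    if "i \<in> {2..n - 1}" for i
    by (subst card_SigmaI, simp add: finite_sorts_well, simp add: finite_sorts_well finite_SigmaI,
        subst card_SigmaI, simp add: finite_sorts_well, simp,
        simp only: two[OF that] cong: sum.cong, simp add: sum_constant)
  then show ?thesis
    unfolding glue_data_def
    by (subst card_SigmaI) (auto simp: finite_sorts_well finite_SigmaI sum_distrib_left)
qed

text \<open>
  The maximum separates the two parts, and the values of the first part, which fill the nonempty
  interval from \<open>t + 1\<close>, reveal \<open>t\<close>.
\<close>

lemma inj_on_glue: "inj_on (\<lambda>(i, l, r, t). glue l r t) (glue_data n)"
proof (rule inj_onI, clarify)
  fix i l r t i' l' r' t'
  assume d: "(i, l, r, t) \<in> glue_data n" and d': "(i', l', r', t') \<in> glue_data n"
    and eq: "glue l r t = glue l' r' t'"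
  from d obtain i: "2 \<le> i" "i < n" and l: "l \<in> sorts_well (i - 1)"
    and r: "r \<in> sorts_well (n - i)" and t: "t \<le> n - i"
    by (rule glue_dataE)
  from d' obtain i': "2 \<le> i'" "i' < n" and l': "l' \<in> sorts_well (i' - 1)"
    and r': "r' \<in> sorts_well (n - i')" and t': "t' \<le> n - i'"
    by (rule glue_dataE)
  have len: "length l = i - 1" "length r = n - i" "length l' = i' - 1" "length r' = n - i'"
    using l r l' r' by (auto dest: length_sorts_well)
  have glue: "glue l r t = map (\<lambda>x. x + t) l @ n # map (open_gap t (i - 1)) r"
      "glue l' r' t' = map (\<lambda>x. x + t') l' @ n # map (open_gap t' (i' - 1)) r'"
    using i i' by (simp_all add: glue_def len)
  have "n \<notin> set (map (\<lambda>x. x + t) l)" "n \<notin> set (map (open_gap t (i - 1)) r)"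
    using l r t i by (auto simp: sorts_well_iff open_gap_def split: if_splits)
  then have parts: "map (\<lambda>x. x + t) l = map (\<lambda>x. x + t') l'"
      "map (open_gap t (i - 1)) r = map (open_gap t' (i' - 1)) r'"
    using eq unfolding glue by (auto simp: append_Cons_eq_iff)
  have "length l = length l'"
    using arg_cong[OF parts(1), of length] by simp
  then have "i = i'"
    using len i i' by simp
  have "{t + 1..t + (i - 1)} = set (map (\<lambda>x. x + t) l)"
    using l image_add_block[of t "i - 1"] by (simp add: sorts_well_iff)
  also have "\<dots> = {t' + 1..t' + (i - 1)}"
    unfolding parts(1) using l' image_add_block[of t' "i - 1"] \<open>i = i'\<close>
    by (simp add: sorts_well_iff)
  finally have "t = t'"
    using i unfolding Icc_eq_Icc by linarith
  then show "i = i' \<and> (l, r, t) = (l', r', t')"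
    using parts \<open>i = i'\<close> inj_open_gap by (auto simp: inj_map_eq_map inj_def)
qed

text \<open>
  Surjectivity: the entries before the maximum form a block of values, and undoing the two shifts
  recovers the parts that were glued.
\<close>

lemma inner_max_is_glue:
  assumes p: "L @ n # R \<in> sorts_well n" and "L \<noteq> []" "R \<noteq> []"
  shows "L @ n # R \<in> (\<lambda>(i, l, r, t). glue l r t) ` glue_data n"
proof -
  define k m where "k = length L" and "m = length R"
  have dist: "distinct L" "distinct R" "set L \<inter> set R = {}" "n \<notin> set L \<union> set R"
    and all: "set (L @ n # R) = {1..n}"
    using p by (auto simp: sorts_well_iff)
  have km: "0 < k" "0 < m"
    using assms by (simp_all add: k_def m_def)
  have n: "n = k + m + 1"
    using length_sorts_well[OF p] by (simp add: k_def m_def)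
  have union: "set L \<union> set R = {1..m + k}"
  proof -
    have "set L \<union> set R = set (L @ n # R) - {n}"
      using dist(4) by auto
    also have "\<dots> = {1..m + k}"
      unfolding all unfolding n by auto
    finally show ?thesis .
  qed
  have "stack_sort (L @ n # R) = stack_sort L @ stack_sort R @ [n]"
    by (rule stack_sort_split) (use union n in auto)
  then have "never_between (set L) (stack_sort R)"
    using p dist by (simp add: sorts_well_iff never_between_append set_stack_sort)
  moreover have "set L \<noteq> {}" "card (set L) = k"
    using assms(2) dist(1) by (simp_all add: k_def distinct_card)
  moreover have "set L \<inter> set (stack_sort R) = {}" "set L \<union> set (stack_sort R) = {1..m + k}"
    using dist(2,3) union by (simp_all add: set_stack_sort)
  ultimately obtain t where t: "set L = {t + 1..t + k}" "t + k \<le> m + k"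
    by (metis never_between_complement_is_block)
  then have "t \<le> m"
    by simp
  have R: "set R = open_gap t k ` {1..m}"
    unfolding image_open_gap[OF \<open>t \<le> m\<close>] t(1)[symmetric] using dist(3) union by auto
  define l where "l = map (\<lambda>y. y - t) L"
  define r where "r = map (inv (open_gap t k)) R"
  have L_l: "map (\<lambda>x. x + t) l = L"
    unfolding l_def map_map by (rule map_idI) (use t in auto)
  have R_r: "map (open_gap t k) r = R"
    unfolding r_def map_map by (rule map_idI) (use R in \<open>auto simp: f_inv_into_f\<close>)
  have l: "distinct l" "set l = {1..k}"
  proof -
    show "distinct l"
      using dist(1) unfolding L_l[symmetric] by (simp add: distinct_map)
    have "(\<lambda>x. x + t) ` set l = (\<lambda>x. x + t) ` {1..k}"
      using t(1) unfolding image_add_block L_l[symmetric] by simp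
    then show "set l = {1..k}"
      by (rule inj_image_eq_iff[THEN iffD1, rotated]) (simp add: inj_def)
  qed
  have r: "distinct r" "set r = {1..m}"
  proof -
    show "distinct r"
      using dist(2) unfolding R_r[symmetric] by (simp add: distinct_map)
    have "open_gap t k ` set r = open_gap t k ` {1..m}"
      using R unfolding R_r[symmetric] by simp
    then show "set r = {1..m}"
      using inj_image_eq_iff[OF inj_open_gap] by blast
  qed
  have "length l = k" "length r = m"
    by (simp_all add: l_def r_def k_def m_def)
  then have glue: "glue l r t = L @ n # R"
    by (simp add: glue_def L_l R_r n)
  then have "l \<in> sorts_well k \<and> r \<in> sorts_well m \<and>
      t \<in> {hd (stack_sort r) - 1, hd (stack_sort r)}"
    using glue_in_sorts_well_iff[OF l r \<open>t \<le> m\<close> km] p n by simp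
  then have "(k + 1, l, r, t) \<in> glue_data n"
    using km n by (auto simp: glue_data_def)
  then show ?thesis
    unfolding glue[symmetric] by (rule rev_image_eqI) simp
qed

lemma glue_in_sorts_well:
  assumes "(i, l, r, t) \<in> glue_data n"
  shows "glue l r t \<in> sorts_well n"
  using assms
proof (rule glue_dataE)
  assume *: "2 \<le> i" "i < n" "l \<in> sorts_well (i - 1)" "r \<in> sorts_well (n - i)" "t \<le> n - i"
    "t \<in> {hd (stack_sort r) - 1, hd (stack_sort r)}"
  then have "glue l r t \<in> sorts_well ((i - 1) + (n - i) + 1)"
    by (subst glue_in_sorts_well_iff) (auto simp: sorts_well_iff)
  then show ?thesis
    using * by simp
qed

lemma max_at_end_in_sorts_well_iff:
  assumes "0 < n"
  shows "p @ [n] \<in> sorts_well n \<longleftrightarrow> p \<in> sorts_well (n - 1)"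
    and "n # p \<in> sorts_well n \<longleftrightarrow> p \<in> sorts_well (n - 1)"
proof -
  have perm: "set p = {1..n - 1} \<longleftrightarrow> insert n (set p) = {1..n} \<and> n \<notin> set p"
  proof -
    have "{1..n} = insert n {1..n - 1}" "n \<notin> {1..n - 1}"
      using assms by auto
    then show ?thesis
      by (metis insert_ident)
  qed
  have srt: "stack_sort (p @ [n]) = stack_sort p @ [n]" "stack_sort (n # p) = stack_sort p @ [n]"
    if "set p = {1..n - 1}"
    using that assms stack_sort_split[of p "[]" n] stack_sort_split[of "[]" p n]
    by (simp_all, fastforce+)
  have nb: "never_between {} (stack_sort p @ [n]) \<longleftrightarrow> never_between {} (stack_sort p)"
    if "set p = {1..n - 1}" "distinct p"
    using that by (auto simp: never_between_append set_stack_sort)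
  show "p @ [n] \<in> sorts_well n \<longleftrightarrow> p \<in> sorts_well (n - 1)"
    using perm srt nb by (auto simp: sorts_well_iff)
  show "n # p \<in> sorts_well n \<longleftrightarrow> p \<in> sorts_well (n - 1)"
    using perm srt nb by (auto simp: sorts_well_iff)
qed

lemma sorts_well_decomposition:
  assumes "2 \<le> n"
  shows "sorts_well n = (\<lambda>p. p @ [n]) ` sorts_well (n - 1) \<union> (\<lambda>p. n # p) ` sorts_well (n - 1)
    \<union> (\<lambda>(i, l, r, t). glue l r t) ` glue_data n" (is "_ = ?A \<union> ?B \<union> ?C")
proof
  have "0 < n"
    using assms by simp
  note ends = max_at_end_in_sorts_well_iff[OF this]
  show "?A \<union> ?B \<union> ?C \<subseteq> sorts_well n"
    using ends by (auto intro: glue_in_sorts_well)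
  show "sorts_well n \<subseteq> ?A \<union> ?B \<union> ?C"
  proof
    fix p
    assume p: "p \<in> sorts_well n"
    then have "n \<in> set p"
      using assms by (auto simp: sorts_well_iff)
    then obtain L R where LR: "p = L @ n # R"
      by (meson split_list)
    consider "R = []" | "L = []" | "L \<noteq> []" "R \<noteq> []"
      by blast
    then show "p \<in> ?A \<union> ?B \<union> ?C"
    proof cases
      case 3
      then show ?thesis
        using inner_max_is_glue p LR by blast
    qed (use p LR ends in auto)
  qed
qed

lemma b_seq_recurrence:
  assumes "2 \<le> n"
  shows "b_seq n = 2 * b_seq (n - 1) + 2 * (\<Sum>i = 2..n - 1. b_seq (i - 1) * b_seq (n - i))"
proof -
  let ?A = "(\<lambda>p. p @ [n]) ` sorts_well (n - 1)" and ?B = "(\<lambda>p. n # p) ` sorts_well (n - 1)"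
    and ?C = "(\<lambda>(i, l, r, t). glue l r t) ` glue_data n"
  \<comment> \<open>The position of the maximum tells the three parts of the decomposition apart.\<close>
  have last: "last (glue l r t) \<noteq> n" and hd: "hd (glue l r t) \<noteq> n"
    if "(i, l, r, t) \<in> glue_data n" for i l r t
  proof -
    from that obtain i: "2 \<le> i" "i < n" and l: "l \<in> sorts_well (i - 1)"
      and r: "r \<in> sorts_well (n - i)" and t: "t \<le> n - i"
      by (rule glue_dataE)
    have ne: "l \<noteq> []" "r \<noteq> []"
      using length_sorts_well[OF l] length_sorts_well[OF r] i by auto
    have dist: "distinct (glue l r t)" 
      using glue_in_sorts_well[OF that] by (simp add: sorts_well_iff)
    moreover have "glue l r t = map (\<lambda>x. x + t) l @ n # map (open_gap t (i - 1)) r"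
      using i length_sorts_well[OF l] length_sorts_well[OF r] by (simp add: glue_def)
    ultimately have "n \<notin> set (map (\<lambda>x. x + t) l)" "n \<notin> set (map (open_gap t (i - 1)) r)"
      and eq: "glue l r t = map (\<lambda>x. x + t) l @ n # map (open_gap t (i - 1)) r"
      by auto
    then show "last (glue l r t) \<noteq> n" "hd (glue l r t) \<noteq> n"
      using ne last_in_set[of "map (open_gap t (i - 1)) r"] hd_in_set[of "map (\<lambda>x. x + t) l"]
      by (auto simp: eq)
  qed
  have AB: "?A \<inter> ?B = {}"
  proof -
    have "p @ [n] \<noteq> n # q" if "p \<in> sorts_well (n - 1)" for p q
    proof (cases p)
      case Nil
      then show ?thesis
        using length_sorts_well[OF that] assms by simp
    next
      case (Cons x xs)
      then show ?thesis
        using that assms by (auto simp: sorts_well_iff) (metis Suc_pred atLeastAtMost_iff insertI1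
          not_less_eq_eq le_refl less_le_trans pos2)
    qed
    then show ?thesis by blast
  qed
  have ABC: "(?A \<union> ?B) \<inter> ?C = {}"
    using last hd by (fastforce dest: arg_cong[of _ _ last] arg_cong[of _ _ hd])
  have fin: "finite (glue_data n)"
    unfolding glue_data_def by (intro finite_SigmaI finite_sorts_well) auto
  have "card (sorts_well n) = card ?A + card ?B + card ?C"
    unfolding sorts_well_decomposition[OF assms]
    by (simp only: card_Un_disjoint[OF _ _ ABC] card_Un_disjoint[OF _ _ AB]
        finite_UnI finite_imageI finite_sorts_well fin)
  also have "\<dots> = 2 * card (sorts_well (n - 1)) + card (glue_data n)"
    by (simp add: card_image inj_on_def[of "\<lambda>p. p @ [n]"] inj_on_glue)
  also have "\<dots> = 2 * b_seq (n - 1) + 2 * (\<Sum>i = 2..n - 1. b_seq (i - 1) * b_seq (n - i))"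
  proof -
    have "(\<Sum>i = 2..n - 1. card (sorts_well (i - 1)) * card (sorts_well (n - i))) =
        (\<Sum>i = 2..n - 1. b_seq (i - 1) * b_seq (n - i))"
      by (rule sum.cong) (auto simp: b_seq_eq_card_sorts_well)
    then show ?thesis
      using assms by (simp add: card_glue_data b_seq_eq_card_sorts_well)
  qed
  finally show ?thesis
    using assms by (simp add: b_seq_eq_card_sorts_well)
qed


section \<open>The recurrence for trees\<close>

definition trees :: "nat \<Rightarrow> zero_one_tree set" where
  "trees n = {t. num_vertices t = n}"

lemma num_vertices_pos: "0 < num_vertices t"
  by (induction t) auto

lemma UNIV_label: "(UNIV :: label set) = {Zero, One}"
  using label.exhaust by blast

lemma trees_decomposition:
  assumes "2 \<le> n"
  shows "trees n = Left_Only ` trees (n - 1) \<union> Right_Only ` trees (n - 1) \<union>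
    (\<lambda>(i, c, l, r). Both c l r) ` (SIGMA i:{2..n - 1}. UNIV \<times> trees (i - 1) \<times> trees (n - i))"
    (is "_ = ?T")
proof (rule set_eqI)
  fix t
  show "t \<in> trees n \<longleftrightarrow> t \<in> ?T"
  proof (cases t)
    case (Both c l r)
    have "t \<in> ?T" if "t \<in> trees n"
    proof (rule UnI2, rule image_eqI)
      show "t = (\<lambda>(i, c, l, r). Both c l r) (num_vertices l + 1, c, l, r)"
        by (simp add: Both)
      show "(num_vertices l + 1, c, l, r) \<in>
          (SIGMA i:{2..n - 1}. UNIV \<times> trees (i - 1) \<times> trees (n - i))"
        using that num_vertices_pos[of l] num_vertices_pos[of r] by (auto simp: trees_def Both)
    qed
    moreover have "t \<in> trees n" if "t \<in> ?T"
      using that by (auto simp: trees_def Both)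
    ultimately show ?thesis by blast
  qed (use assms in \<open>auto simp: trees_def\<close>)
qed

lemma trees_1: "trees 1 = {Leaf}"
proof -
  have "num_vertices t = 1 \<longleftrightarrow> t = Leaf" for t
    using num_vertices_pos by (cases t) (auto simp: less_not_refl2)
  then show ?thesis
    by (auto simp: trees_def)
qed

lemma finite_trees: "finite (trees n)"
proof (induction n rule: less_induct)
  case (less n)
  consider "n = 0" | "n = 1" | "2 \<le> n"
    by linarith
  then show ?case
  proof cases
    case 1
    then show ?thesis
      using num_vertices_pos by (simp add: trees_def less_not_refl2)
  next
    case 2
    then show ?thesis
      using trees_1 by simp
  next
    case 3
    then show ?thesis
      unfolding trees_decomposition[OF 3] using less
      by (intro finite_UnI finite_imageI finite_SigmaI finite_cartesian_product)
        (auto simp: UNIV_label)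
  qed
qed

lemma a_seq_eq_card_trees: "0 < n \<Longrightarrow> a_seq n = card (trees n)"
  by (simp add: a_seq_def trees_def)

lemma a_seq_recurrence:
  assumes "2 \<le> n"
  shows "a_seq n = 2 * a_seq (n - 1) + 2 * (\<Sum>i = 2..n - 1. a_seq (i - 1) * a_seq (n - i))"
proof -
  let ?D = "SIGMA i:{2..n - 1}. (UNIV :: label set) \<times> trees (i - 1) \<times> trees (n - i)"
  let ?A = "Left_Only ` trees (n - 1)" and ?B = "Right_Only ` trees (n - 1)"
    and ?C = "(\<lambda>(i, c, l, r). Both c l r) ` ?D"
  have fin: "finite ?D"
    by (intro finite_SigmaI finite_cartesian_product finite_trees) (auto simp: UNIV_label)
  have inj: "inj_on (\<lambda>(i, c, l, r). Both c l r) ?D"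
    by (rule inj_onI) (auto simp: trees_def)
  have D: "card ?D = 2 * (\<Sum>i = 2..n - 1. card (trees (i - 1)) * card (trees (n - i)))"
    by (subst card_SigmaI)
      (simp_all add: finite_trees UNIV_label card_cartesian_product sum_distrib_left flip: mult_2)
  have AB: "?A \<inter> ?B = {}" and ABC: "(?A \<union> ?B) \<inter> ?C = {}"
    by auto
  have "card (trees n) = card ?A + card ?B + card ?C"
    unfolding trees_decomposition[OF assms]
    by (simp only: card_Un_disjoint[OF _ _ ABC] card_Un_disjoint[OF _ _ AB]
        finite_UnI finite_imageI finite_trees fin)
  also have "\<dots> = 2 * card (trees (n - 1)) + card ?D"
    unfolding card_image[OF inj] by (simp add: card_image inj_on_def)
  also have "\<dots> = 2 * a_seq (n - 1) + 2 * (\<Sum>i = 2..n - 1. a_seq (i - 1) * a_seq (n - i))"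
  proof -
    have "(\<Sum>i = 2..n - 1. card (trees (i - 1)) * card (trees (n - i))) =
        (\<Sum>i = 2..n - 1. a_seq (i - 1) * a_seq (n - i))"
      by (rule sum.cong) (auto simp: a_seq_eq_card_trees)
    then show ?thesis
      unfolding D using assms by (simp add: a_seq_eq_card_trees)
  qed
  finally show ?thesis
    using assms by (simp add: a_seq_eq_card_trees)
qed


section \<open>Equality of the two sequences\<close>

lemma b_seq_1: "b_seq 1 = 1"
proof -
  have "sorts_well 1 = {[1]}"
    by (auto simp: sorts_well_def stack_sort_singleton)
  then show ?thesis
    by (simp add: b_seq_eq_card_sorts_well)
qed

lemma a_seq_1: "a_seq 1 = 1"
  using trees_1 by (simp add: a_seq_eq_card_trees)

lemma a_seq_eq_b_seq: "a_seq n = b_seq n"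
proof (induction n rule: less_induct)
  case (less n)
  consider "n = 0" | "n = 1" | "2 \<le> n"
    by linarith
  then show ?case
  proof cases
    case 1
    then show ?thesis
      by (simp add: a_seq_def b_seq_def)
  next
    case 2
    then show ?thesis
      using a_seq_1 b_seq_1 by simp
  next
    case 3
    have "(\<Sum>i = 2..n - 1. a_seq (i - 1) * a_seq (n - i)) =
        (\<Sum>i = 2..n - 1. b_seq (i - 1) * b_seq (n - i))"
      by (rule sum.cong) (auto simp: less)
    then show ?thesis
      unfolding a_seq_recurrence[OF 3] b_seq_recurrence[OF 3] using less[of "n - 1"] 3 by simp
  qed
qed

theorem theorem3p1:
  shows "(\<forall>n\<ge>2. b_seq n = 2 * b_seq (n - 1) + 2 * (\<Sum>i = 2..n - 1. b_seq (i - 1) * b_seq (n - i)))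
       \<and> (\<forall>n\<ge>2. a_seq n = 2 * a_seq (n - 1) + 2 * (\<Sum>i = 2..n - 1. a_seq (i - 1) * a_seq (n - i)))
       \<and> a_seq 1 = 1 \<and> b_seq 1 = 1
       \<and> (\<forall>n. a_seq n = b_seq n)"
  using b_seq_recurrence a_seq_recurrence a_seq_1 b_seq_1 a_seq_eq_b_seq by blast

end
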